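(* Let $\Omega$ be an open subset of $\mathbb{R}^d$, and for each $k \in \mathbb{N}$ let $f_k: \Omega \to \mathbb{R}$ be an everywhere differentiable function belonging to $W^{1,\infty}(\Omega)$. Assume that $f_k \to f$ in $W^{1,\infty}(\Omega)$. Then $f$ is everywhere differentiable in $\Omega$, and further $f_k \to f$ and $\nabla f_k \to \nabla f$ uniformly on $\Omega$.
   Context: $W^{1,\infty}(\Omega)$ is the Sobolev space of (a.e.-equivalence classes of) functions in $L^\infty(\Omega)$ with weak gradient in $L^\infty(\Omega)$, with norm $\|u\|_{L^\infty(\Omega)} + \|\nabla u\|_{L^\infty(\Omega)}$. The element $f \in W^{1,\infty}(\Omega)$ is identified with its continuous representative. In the conclusion, $\nabla f_k$ and $\nabla f$ are the classical pointwise gradients. *)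

theory Defs
  imports "HOL-Analysis.Analysis" "HOL-Probability.Essential_Supremum"
begin

text \<open>Functions on an open set \<open>\<Omega>\<close> are total functions whose values outside \<open>\<Omega>\<close> are irrelevant;
  elements of a Lebesgue or Sobolev space on \<open>\<Omega>\<close> are given by arbitrary representatives.\<close>

definition grad :: "('a::euclidean_space \<Rightarrow> real) \<Rightarrow> 'a \<Rightarrow> 'a"
  where "grad f x = (THE D. GDERIV f x :> D)"

lemma grad_eqI:
  assumes "GDERIV f x :> D"
  shows "grad f x = D"
  unfolding grad_def
proof (rule the_equality, rule assms)
  fix E assume "GDERIV f x :> E"
  with assms have "(\<lambda>h. inner h E) = (\<lambda>h. inner h D)"
    unfolding gderiv_def by (metis has_derivative_unique)
  then show "E = D"
    by (metis inner_commute vector_eq_ldot)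
qed

lemma gderiv_grad:
  assumes "f differentiable (at x)"
  shows "GDERIV f x :> grad f x"
proof -
  obtain f' where f': "(f has_derivative f') (at x)"
    using assms by (auto simp: differentiable_def)
  then have lin: "linear f'"
    by (rule has_derivative_linear)
  have "f' h = inner h (adjoint f' 1)" for h
    using adjoint_works[OF lin, of h 1] by simp
  with f' have "GDERIV f x :> adjoint f' 1"
    unfolding gderiv_def by (metis (no_types, lifting) ext)
  then show ?thesis
    using grad_eqI by metis
qed

primrec Ck :: "nat \<Rightarrow> ('a::euclidean_space \<Rightarrow> real) \<Rightarrow> bool"
  where
    "Ck 0 \<phi> \<longleftrightarrow> continuous_on UNIV \<phi>"
  | "Ck (Suc k) \<phi> \<longleftrightarrow> (\<forall>x. \<phi> differentiable (at x)) \<and>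
       (\<forall>i\<in>Basis. Ck k (\<lambda>x. frechet_derivative \<phi> (at x) i))"

text \<open>\<open>C\<^sub>c\<^sup>\<infinity>(\<Omega>)\<close>, its members being extended by zero to the whole space.\<close>

definition test_function :: "'a::euclidean_space set \<Rightarrow> ('a \<Rightarrow> real) \<Rightarrow> bool"
  where "test_function \<Omega> \<phi> \<longleftrightarrow>
    (\<forall>k. Ck k \<phi>) \<and> compact (closure {x. \<phi> x \<noteq> 0}) \<and> closure {x. \<phi> x \<noteq> 0} \<subseteq> \<Omega>"

definition locally_integrable ::
    "'a::euclidean_space set \<Rightarrow> ('a \<Rightarrow> 'b::{banach, second_countable_topology}) \<Rightarrow> bool"
  where "locally_integrable \<Omega> u \<longleftrightarrow>
    (\<forall>K. compact K \<and> K \<subseteq> \<Omega> \<longrightarrow> integrable (lebesgue_on K) u)"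

definition is_weak_gradient ::
    "'a::euclidean_space set \<Rightarrow> ('a \<Rightarrow> real) \<Rightarrow> ('a \<Rightarrow> 'a) \<Rightarrow> bool"
  where "is_weak_gradient \<Omega> u g \<longleftrightarrow>
    locally_integrable \<Omega> u \<and> locally_integrable \<Omega> g \<and>
    (\<forall>\<phi>. test_function \<Omega> \<phi> \<longrightarrow>
      (\<forall>i\<in>Basis. (LINT x|lebesgue_on \<Omega>. u x * frechet_derivative \<phi> (at x) i) =
        - (LINT x|lebesgue_on \<Omega>. inner (g x) i * \<phi> x)))"

text \<open>A weak gradient is unique up to a null set, so nothing below depends on the choice.\<close>

definition weak_grad :: "'a::euclidean_space set \<Rightarrow> ('a \<Rightarrow> real) \<Rightarrow> 'a \<Rightarrow> 'a"
  where "weak_grad \<Omega> u = (SOME g. is_weak_gradient \<Omega> u g)"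

text \<open>The essential supremum is taken in \<open>ennreal\<close>, so that it is \<open>0\<close> (not \<open>-\<infinity>\<close>) when \<open>\<Omega>\<close> is empty.\<close>

definition Linf_norm :: "'a::euclidean_space set \<Rightarrow> ('a \<Rightarrow> 'b::euclidean_space) \<Rightarrow> ennreal"
  where "Linf_norm \<Omega> u = esssup (lebesgue_on \<Omega>) (\<lambda>x. ennreal (norm (u x)))"

definition Linf :: "'a::euclidean_space set \<Rightarrow> ('a \<Rightarrow> 'b::euclidean_space) set"
  where "Linf \<Omega> = {u \<in> borel_measurable (lebesgue_on \<Omega>). Linf_norm \<Omega> u < \<infinity>}"

definition W1inf :: "'a::euclidean_space set \<Rightarrow> ('a \<Rightarrow> real) set"
  where "W1inf \<Omega> = {u \<in> Linf \<Omega>. \<exists>g\<in>Linf \<Omega>. is_weak_gradient \<Omega> u g}"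

definition W1inf_norm :: "'a::euclidean_space set \<Rightarrow> ('a \<Rightarrow> real) \<Rightarrow> ennreal"
  where "W1inf_norm \<Omega> u = Linf_norm \<Omega> u + Linf_norm \<Omega> (weak_grad \<Omega> u)"

definition W1inf_tendsto :: "'a::euclidean_space set \<Rightarrow> (nat \<Rightarrow> 'a \<Rightarrow> real) \<Rightarrow> ('a \<Rightarrow> real) \<Rightarrow> bool"
  where "W1inf_tendsto \<Omega> f l \<longleftrightarrow>
    (\<forall>k. f k \<in> W1inf \<Omega>) \<and> l \<in> W1inf \<Omega> \<and>
    (\<lambda>k. W1inf_norm \<Omega> (\<lambda>x. f k x - l x)) \<longlonglongrightarrow> 0"

text \<open>For open \<open>\<Omega>\<close> there is at most one such \<open>g\<close>, up to its values outside \<open>\<Omega>\<close>.\<close>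

definition continuous_representative ::
    "'a::euclidean_space set \<Rightarrow> ('a \<Rightarrow> real) \<Rightarrow> ('a \<Rightarrow> real) \<Rightarrow> bool"
  where "continuous_representative \<Omega> f g \<longleftrightarrow>
    continuous_on \<Omega> g \<and> (AE x in lebesgue_on \<Omega>. g x = f x)"

end

theory Submission
  imports Defs
begin

text \<open>The point is that for a function \<open>u\<close> differentiable at \<open>x\<close> with weak gradient essentially
  bounded by \<open>\<epsilon>\<close>, the classical gradient satisfies \<open>norm (grad u x) \<le> \<epsilon>\<close>. To see it, subtract the
  first-order Taylor polynomial at \<open>x\<close> and test the weak gradient of the remainder against smooth
  bumps concentrating at \<open>x\<close>; the remainder is \<open>o(r)\<close> on a ball of radius \<open>r\<close>, which beats the
  \<open>O(1 / r)\<close> derivative of the bump. Applied to \<open>f m - f n\<close> at every point of \<open>\<Omega>\<close>, this makes the classical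
  gradients uniformly Cauchy, and the classical theorem on termwise differentiation applies.\<close>

section \<open>Closure properties of the classes \<open>Ck k\<close>\<close>

text \<open>Derivatives are unique, so a derivative \<open>D\<close> computed by hand may replace
  the \<open>frechet_derivative\<close> in the definition of \<open>Ck\<close>.\<close>

lemma Ck_SucI:
  assumes "\<And>x. (\<phi> has_derivative D x) (at x)"
    and "\<And>i. i \<in> Basis \<Longrightarrow> Ck k (\<lambda>x. D x i)"
  shows "Ck (Suc k) \<phi>"
proof -
  have "frechet_derivative \<phi> (at x) = D x" for x
    using frechet_derivative_at[OF assms(1)] by simp
  then show ?thesis
    using assms by (auto simp: differentiable_def)
qed

lemma Ck_SucD:
  assumes "Ck (Suc k) \<phi>"
  shows "(\<phi> has_derivative frechet_derivative \<phi> (at x)) (at x)"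
    and "i \<in> Basis \<Longrightarrow> Ck k (\<lambda>x. frechet_derivative \<phi> (at x) i)"
  using assms by (auto simp: frechet_derivative_works)

text \<open>Differentiability gives continuity at the bottom; above it, the induction lowers the
  order of each partial derivative. The product and chain rules need this for the factor that stays
  undifferentiated.\<close>

lemma Ck_Suc_imp: "Ck (Suc k) \<phi> \<Longrightarrow> Ck k \<phi>"
proof (induction k arbitrary: \<phi>)
  case 0
  then show ?case
    by (auto simp: continuous_on_eq_continuous_at differentiable_imp_continuous_within)
next
  case (Suc k)
  show ?case
    using Ck_SucD(1)[OF Suc.prems]
    by (rule Ck_SucI) (use Suc.IH Ck_SucD(2)[OF Suc.prems] in blast)
qed

lemma Ck_const: "Ck k (\<lambda>x. c)"
proof (induction k arbitrary: c)
  case (Suc k)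
  then show ?case by (intro Ck_SucI[where D = "\<lambda>_ _. 0"]) auto
qed simp

lemma Ck_add: "Ck k \<phi> \<Longrightarrow> Ck k \<psi> \<Longrightarrow> Ck k (\<lambda>x. \<phi> x + \<psi> x)"
proof (induction k arbitrary: \<phi> \<psi>)
  case 0
  then show ?case by (auto intro: continuous_on_add)
next
  case (Suc k)
  show ?case
    by (rule Ck_SucI, rule has_derivative_add[OF Suc.prems[THEN Ck_SucD(1)]])
      (use Suc.IH Suc.prems[THEN Ck_SucD(2)] in blast)
qed

lemma Ck_mult: "Ck k \<phi> \<Longrightarrow> Ck k \<psi> \<Longrightarrow> Ck k (\<lambda>x. \<phi> x * \<psi> x)"
proof (induction k arbitrary: \<phi> \<psi>)
  case 0
  then show ?case by (auto intro: continuous_on_mult)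
next
  case (Suc k)
  show ?case
    by (rule Ck_SucI, rule has_derivative_mult[OF Suc.prems[THEN Ck_SucD(1)]])
      (intro Ck_add Suc.IH Suc.prems[THEN Ck_SucD(2)] Suc.prems[THEN Ck_Suc_imp])
qed

text \<open>No induction is required: the derivative is the same linear map at every point, so its
  partial derivatives are constants.\<close>

lemma Ck_inner: "Ck k (\<lambda>x. (x - a) \<bullet> v)"
proof (cases k)
  case (Suc m)
  show ?thesis
    unfolding Suc
    by (rule Ck_SucI[where D = "\<lambda>_ h. h \<bullet> v"]) (auto intro!: derivative_eq_intros Ck_const)
qed (auto intro!: continuous_intros)

lemma Ck_norm_power2: "Ck k (\<lambda>x::'a::euclidean_space. (norm (x - a))\<^sup>2)"
proof (cases k)
  case (Suc m)
  show ?thesis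
    unfolding Suc
  proof (rule Ck_SucI[where D = "\<lambda>x h. 2 * ((x - a) \<bullet> h)"])
    show "((\<lambda>x. (norm (x - a))\<^sup>2) has_derivative (\<lambda>h. 2 * ((x - a) \<bullet> h))) (at x)" for x :: 'a
      unfolding power2_norm_eq_inner
      by (auto intro!: derivative_eq_intros simp: inner_commute)
    show "Ck m (\<lambda>x::'a. 2 * ((x - a) \<bullet> i))" for i
      by (intro Ck_mult Ck_const Ck_inner)
  qed
qed (auto intro!: continuous_intros)

section \<open>A smooth function on the line that vanishes on the negative half-axis\<close>

text \<open>This family is closed under differentiation, which gives smoothness by induction.\<close>

definition flat_exp :: "real poly \<Rightarrow> real \<Rightarrow> real"
  where "flat_exp p t = (if t > 0 then poly p (1 / t) * exp (- (1 / t)) else 0)"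

lemma poly_times_exp_minus_tendsto_0:
  fixes p :: "real poly"
  shows "((\<lambda>s. poly p s * exp (- s)) \<longlongrightarrow> 0) at_top"
proof -
  have "((\<lambda>s. \<Sum>i\<le>degree p. coeff p i * (s ^ i / exp s)) \<longlongrightarrow> (\<Sum>i\<le>degree p. coeff p i * 0)) at_top"
    by (intro tendsto_intros tendsto_power_div_exp_0)
  then show ?thesis
    by (simp add: poly_altdef sum_distrib_right exp_minus field_simps sum_divide_distrib)
qed

text \<open>From the left the function is zero; from the right, the substitution
  \<open>s = 1 / t\<close> turns the claim into the decay of \<open>poly p s * exp (- s)\<close> at
  infinity.\<close>

lemma flat_exp_tendsto_0: "(flat_exp p \<longlongrightarrow> 0) (at 0)"
proof -
  have "(flat_exp p \<longlongrightarrow> 0) (at_left 0)"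
    by (rule tendsto_eventually) (auto simp: flat_exp_def eventually_at_filter)
  moreover have "(flat_exp p \<longlongrightarrow> 0) (at_right 0)"
    unfolding filterlim_at_right_to_top
  proof (rule Lim_transform_eventually[OF poly_times_exp_minus_tendsto_0])
    show "\<forall>\<^sub>F s in at_top. poly p s * exp (- s) = flat_exp p (inverse s)"
      using eventually_gt_at_top[of 0] by eventually_elim (simp add: flat_exp_def divide_inverse)
  qed
  ultimately show ?thesis
    by (rule filterlim_split_at)
qed

text \<open>With \<open>s = 1 / t\<close> one has \<open>ds/dt = - s^2\<close>, hence the derivative
  of \<open>p(s) * exp (- s)\<close> in \<open>t\<close> is
  \<open>s^2 * (p(s) - p'(s)) * exp (- s)\<close>.\<close>

definition flat_exp_deriv :: "real poly \<Rightarrow> real poly"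
  where "flat_exp_deriv p = monom 1 2 * (p - pderiv p)"

lemma has_real_derivative_flat_exp:
  "(flat_exp p has_real_derivative flat_exp (flat_exp_deriv p) t) (at t)"
proof (cases t "0 :: real" rule: linorder_cases)
  case less
  have "(flat_exp p has_real_derivative 0) (at t)"
    by (rule DERIV_cong_ev[THEN iffD1, OF refl _ refl DERIV_const[of 0]])
      (use eventually_nhds_in_open[of "{..<0}" t] less in \<open>auto simp: flat_exp_def elim!: eventually_mono\<close>)
  with less show ?thesis by (simp add: flat_exp_def)
next
  case equal
  \<comment> \<open>At the origin, dividing by \<open>h\<close> multiplies the polynomial by
    \<open>s = 1 / h\<close>. The difference quotient is therefore again a member of the family,
    which tends to 0.\<close>
  have "((\<lambda>h. (flat_exp p (0 + h) - flat_exp p 0) / h) \<longlongrightarrow> 0) (at 0)"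
  proof (rule Lim_transform_eventually[OF flat_exp_tendsto_0[of "[:0, 1:] * p"]])
    show "\<forall>\<^sub>F h in at 0. flat_exp ([:0, 1:] * p) h = (flat_exp p (0 + h) - flat_exp p 0) / h"
      by (auto simp: flat_exp_def eventually_at_filter)
  qed
  with equal show ?thesis by (simp add: DERIV_def flat_exp_def)
next
  case greater
  have "((\<lambda>t. poly p (1 / t) * exp (- (1 / t))) has_real_derivative
      flat_exp (flat_exp_deriv p) t) (at t)"
    using greater
    by (auto intro!: derivative_eq_intros
        simp: flat_exp_def flat_exp_deriv_def poly_monom field_simps power2_eq_square)
  then show ?thesis
    by (rule DERIV_cong_ev[THEN iffD1, OF refl _ refl, rotated])
      (use eventually_nhds_in_open[of "{0<..}" t] greater in \<open>auto simp: flat_exp_def elim!: eventually_mono\<close>)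
qed

lemma has_derivative_flat_exp_compose:
  assumes "(\<phi> has_derivative \<phi>') (at x)"
  shows "((\<lambda>x. flat_exp p (\<phi> x)) has_derivative
    (\<lambda>h. flat_exp (flat_exp_deriv p) (\<phi> x) * \<phi>' h)) (at x)"
  using has_derivative_compose[OF assms has_real_derivative_flat_exp[THEN has_field_derivative_imp_has_derivative]]
  by simp

text \<open>The induction must leave \<open>p\<close> arbitrary, because differentiating replaces it
  by \<open>flat_exp_deriv p\<close>.\<close>

lemma Ck_flat_exp: "Ck k \<phi> \<Longrightarrow> Ck k (\<lambda>x. flat_exp p (\<phi> x))"
proof (induction k arbitrary: p)
  case 0
  have "continuous_on UNIV (flat_exp p)"
    by (meson DERIV_continuous_on has_field_derivative_at_within has_real_derivative_flat_exp)
  with 0 show ?case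
    by (auto intro: continuous_on_compose2)
next
  case (Suc k)
  show ?case
    by (rule Ck_SucI, rule has_derivative_flat_exp_compose[OF Ck_SucD(1)[OF Suc.prems]])
      (intro Ck_mult Suc.IH Ck_SucD(2)[OF Suc.prems] Ck_Suc_imp[OF Suc.prems])
qed

section \<open>Bump functions on balls, with explicit bounds\<close>

text \<open>This is the standard mollifier \<open>exp (- 1 / (1 - |y - a|^2 / r^2))\<close>, left
  unnormalised. The squared norm keeps it smooth at the centre.\<close>

definition bump :: "'a::euclidean_space \<Rightarrow> real \<Rightarrow> 'a \<Rightarrow> real"
  where "bump a r y = flat_exp 1 (1 - (norm (y - a))\<^sup>2 / r\<^sup>2)"

lemma Ck_bump: "Ck k (bump a r)"
proof -
  have "Ck k (\<lambda>y. flat_exp 1 (1 + (-1 / r\<^sup>2) * (norm (y - a))\<^sup>2))"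
    by (intro Ck_flat_exp Ck_add Ck_mult Ck_const Ck_norm_power2)
  then show ?thesis
    by (simp add: bump_def[abs_def])
qed

lemma bump_nonneg: "0 \<le> bump a r y"
  by (simp add: bump_def flat_exp_def)

text \<open>Stated for all \<open>p\<close> in order to cover both the bump and its
  derivative.\<close>

lemma flat_exp_outside_ball:
  assumes "0 < r" "y \<notin> ball a r"
  shows "flat_exp p (1 - (norm (y - a))\<^sup>2 / r\<^sup>2) = 0"
proof -
  have "r\<^sup>2 \<le> (norm (y - a))\<^sup>2"
    using assms by (intro power_mono) (auto simp: dist_norm norm_minus_commute)
  with assms have "1 \<le> (norm (y - a))\<^sup>2 / r\<^sup>2"
    by (simp add: le_divide_eq)
  then show ?thesis
    unfolding flat_exp_def by auto
qed

lemma bump_eq_0: "0 < r \<Longrightarrow> y \<notin> ball a r \<Longrightarrow> bump a r y = 0"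
  unfolding bump_def by (rule flat_exp_outside_ball)

lemma closure_support_bump:
  assumes "0 < r"
  shows "closure {y. bump a r y \<noteq> 0} \<subseteq> cball a r"
  by (rule closure_minimal) (use bump_eq_0[OF assms, of _ a] in \<open>auto simp: not_less[symmetric]\<close>)

lemma test_function_bump:
  assumes "0 < r" "cball a r \<subseteq> \<Omega>"
  shows "test_function \<Omega> (bump a r)"
  unfolding test_function_def
  using closure_support_bump[OF assms(1), of a] assms(2) Ck_bump
  by (auto intro: bounded_subset[OF bounded_cball] simp: compact_eq_bounded_closed)

text \<open>Within half the radius the argument of the profile is at least \<open>3 / 4\<close>, and
  \<open>exp (- 1 / t)\<close> increases with \<open>t\<close>.\<close>

lemma bump_ge:
  assumes "0 < r" "y \<in> cball a (r / 2)"
  shows "exp (- (4 / 3)) \<le> bump a r y"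
proof -
  have "(norm (y - a))\<^sup>2 \<le> (r / 2)\<^sup>2"
    using assms by (intro power_mono) (auto simp: dist_norm norm_minus_commute)
  then have "(norm (y - a))\<^sup>2 / r\<^sup>2 \<le> 1 / 4"
    using assms by (simp add: field_simps power2_eq_square)
  then have "3 / 4 \<le> 1 - (norm (y - a))\<^sup>2 / r\<^sup>2"
    by simp
  then show ?thesis
    unfolding bump_def flat_exp_def by (auto simp: field_simps)
qed

text \<open>For positive \<open>t\<close> and \<open>s = 1 / t\<close> the value is
  \<open>s^2 * exp (- s)\<close>, and \<open>exp s\<close> is at least its quadratic Taylor term
  \<open>s^2 / 2\<close>.\<close>

lemma flat_exp_deriv_1_bounds: "0 \<le> flat_exp (flat_exp_deriv 1) t" "flat_exp (flat_exp_deriv 1) t \<le> 2"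
proof -
  have "s\<^sup>2 * exp (- s) \<le> 2" if "0 < s" for s :: real
    using exp_lower_Taylor_quadratic[of s] that by (simp add: exp_minus field_simps power2_eq_square)
  from this[of "1 / t"] show "flat_exp (flat_exp_deriv 1) t \<le> 2"
    by (simp add: flat_exp_def flat_exp_deriv_def poly_monom)
qed (simp add: flat_exp_def flat_exp_deriv_def poly_monom)

text \<open>By the chain rule, the factor 4 is the bound 2 on the derivative of the profile times
  the 2 from differentiating the square. One power of \<open>r\<close> cancels since
  \<open>|y - a| \<le> r\<close> on the ball.\<close>

lemma frechet_derivative_bump_le:
  assumes "0 < r"
  shows "\<bar>frechet_derivative (bump a r) (at y) v\<bar> \<le> 4 * norm v / r * indicator (cball a r) y"
proof -
  let ?d = "flat_exp (flat_exp_deriv 1) (1 - (norm (y - a))\<^sup>2 / r\<^sup>2)"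
  have "((\<lambda>y. 1 - (norm (y - a))\<^sup>2 / r\<^sup>2) has_derivative (\<lambda>h. - (2 * ((y - a) \<bullet> h) / r\<^sup>2))) (at y)"
    unfolding power2_norm_eq_inner
    by (auto intro!: derivative_eq_intros simp: inner_commute divide_inverse)
  from has_derivative_flat_exp_compose[OF this, of 1]
  have "frechet_derivative (bump a r) (at y) = (\<lambda>h. ?d * - (2 * ((y - a) \<bullet> h) / r\<^sup>2))"
    unfolding bump_def[abs_def] by (rule frechet_derivative_at[symmetric])
  then have *: "\<bar>frechet_derivative (bump a r) (at y) v\<bar> = ?d * (2 * \<bar>(y - a) \<bullet> v\<bar> / r\<^sup>2)"
    using flat_exp_deriv_1_bounds(1) by (simp add: abs_mult)
  show ?thesis
  proof (cases "y \<in> cball a r")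
    case True
    then have "\<bar>(y - a) \<bullet> v\<bar> \<le> r * norm v"
      using Cauchy_Schwarz_ineq2[of "y - a" v]
      by (elim order_trans) (auto simp: dist_norm norm_minus_commute intro: mult_right_mono)
    then have "?d * (2 * \<bar>(y - a) \<bullet> v\<bar> / r\<^sup>2) \<le> 2 * (2 * (r * norm v) / r\<^sup>2)"
      using flat_exp_deriv_1_bounds by (intro mult_mono divide_right_mono) auto
    with * True assms show ?thesis
      by (simp add: power2_eq_square)
  next
    case False
    then have "?d = 0"
      using assms by (intro flat_exp_outside_ball) auto
    with * False show ?thesis by simp
  qed
qed

section \<open>Integrals of derivatives of compactly supported functions\<close>

text \<open>The complement of \<open>K\<close> is open, so \<psi> coincides with zero near
  \<open>y\<close>, and derivatives are unique.\<close>

lemma has_derivative_eq_0_outside_support: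
  fixes \<psi> :: "'a::real_normed_vector \<Rightarrow> 'b::real_normed_vector"
  assumes "(\<psi> has_derivative D) (at y)" "closed K" "y \<notin> K" "\<And>y. y \<notin> K \<Longrightarrow> \<psi> y = 0"
  shows "D = (\<lambda>_. 0)"
proof -
  have "((\<lambda>_. 0) has_derivative D) (at y)"
    using assms by (intro has_derivative_transform_within_open[OF assms(1), of "- K"]) auto
  then show ?thesis
    by (rule has_derivative_unique) simp
qed

lemma
  fixes f :: "'a::euclidean_space \<Rightarrow> 'b::{banach, second_countable_topology}"
  assumes "integrable lborel f"
  shows integrable_lborel_shift: "integrable lborel (\<lambda>x. f (c + x))"
    and integral_lborel_shift: "(LINT x|lborel. f (c + x)) = integral\<^sup>L lborel f"
proof -
  have [measurable]: "f \<in> borel_measurable borel"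
    using borel_measurable_integrable[OF assms] by simp
  have "integrable (distr lborel borel ((+) c)) f"
    unfolding lborel_distr_plus by (rule assms)
  then show "integrable lborel (\<lambda>x. f (c + x))"
    by (subst (asm) integrable_distr_eq) auto
  have "(LINT x|lborel. f (c + x)) = integral\<^sup>L (distr lborel borel ((+) c)) f"
    by (rule integral_distr[symmetric]) auto
  then show "(LINT x|lborel. f (c + x)) = integral\<^sup>L lborel f"
    unfolding lborel_distr_plus .
qed

lemma integrable_lborel_compact_support:
  fixes f :: "'a::euclidean_space \<Rightarrow> 'b::{banach, second_countable_topology}"
  assumes "continuous_on UNIV f" "compact K" "\<And>y. y \<notin> K \<Longrightarrow> f y = 0"
  shows "integrable lborel f"
proof -
  have "indicator K x *\<^sub>R f x = f x" for x
    using assms(3)[of x] by (auto simp: indicator_def)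
  with borel_integrable_compact[OF assms(2) continuous_on_subset[OF assms(1)]] show ?thesis
    by simp
qed

lemma bounded_compact_support:
  fixes f :: "'a::metric_space \<Rightarrow> 'b::real_normed_vector"
  assumes "continuous_on UNIV f" "compact K" "\<And>y. y \<notin> K \<Longrightarrow> f y = 0"
  obtains B where "0 \<le> B" "\<And>y. norm (f y) \<le> B"
proof -
  have "bounded (f ` K)"
    using assms by (intro compact_imp_bounded compact_continuous_image) (auto intro: continuous_on_subset)
  then obtain B where "0 < B" "\<And>y. y \<in> K \<Longrightarrow> norm (f y) \<le> B"
    unfolding bounded_pos by auto
  with assms(3) that[of B] show ?thesis
    by (metis norm_zero order_less_imp_le)
qed

text \<open>Difference quotients in direction \<open>v\<close> integrate to zero by translation invariance;
  dominated convergence passes this on to the derivative.\<close>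

lemma integral_directional_derivative_eq_0:
  fixes \<psi> :: "'a::euclidean_space \<Rightarrow> real"
  assumes der: "\<And>y. (\<psi> has_derivative D y) (at y)"
    and cont: "continuous_on UNIV (\<lambda>y. D y v)"
    and K: "compact K" "\<And>y. y \<notin> K \<Longrightarrow> \<psi> y = 0"
  shows "(LINT y|lborel. D y v) = 0"
proof -
  \<comment> \<open>Any positive null sequence bounded by 1 would do; the bound keeps all shifted
    supports inside one ball.\<close>
  define t :: "nat \<Rightarrow> real" where "t n = 1 / real (Suc n)" for n
  have t: "0 < t n" "t n \<le> 1" for n
    by (auto simp: t_def)
  have t_lim: "filterlim t (at 0) sequentially"
    unfolding filterlim_at t_def using LIMSEQ_inverse_real_of_nat
    by (auto simp: inverse_eq_divide)
  have D_outside: "D y v = 0" if "y \<notin> K" for y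
    using has_derivative_eq_0_outside_support[OF der compact_imp_closed[OF K(1)] that] K(2) by simp
  obtain B where B: "0 \<le> B" "\<And>y. norm (D y v) \<le> B"
    using bounded_compact_support[OF cont K(1)] D_outside by metis
  have \<psi>_cont: "continuous_on UNIV \<psi>"
    using der by (auto simp: continuous_on_eq_continuous_at intro: has_derivative_continuous)
  have \<psi>_int: "integrable lborel \<psi>"
    by (rule integrable_lborel_compact_support[OF \<psi>_cont K])
  obtain \<rho> where \<rho>: "\<And>y. y \<in> K \<Longrightarrow> norm y \<le> \<rho>"
    using compact_imp_bounded[OF K(1)] by (auto simp: bounded_iff)
  \<comment> \<open>Restriction to lines in direction \<open>v\<close> yields both the pointwise
    limit of the quotients and, by the mean value theorem, their bound.\<close>
  have line: "((\<lambda>s. \<psi> (s *\<^sub>R v + y)) has_real_derivative D (s *\<^sub>R v + y) v) (at s)" for s y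
  proof -
    have "((\<lambda>s. s *\<^sub>R v + y) has_derivative (\<lambda>h. h *\<^sub>R v)) (at s)"
      by (auto intro!: derivative_eq_intros)
    from has_derivative_compose[OF this der]
    show ?thesis
      by (simp add: has_field_derivative_def linear_cmul[OF has_derivative_linear[OF der]] mult_commute_abs)
  qed
  let ?s = "\<lambda>n y. (\<psi> (t n *\<^sub>R v + y) - \<psi> y) / t n"
  have "(\<lambda>n. LINT y|lborel. ?s n y) \<longlonglongrightarrow> (LINT y|lborel. D y v)"
  proof (rule integral_dominated_convergence)
    show "(\<lambda>y. D y v) \<in> borel_measurable lborel"
      using borel_measurable_continuous_onI[OF cont] by simp
    show "?s n \<in> borel_measurable lborel" for n
      using borel_measurable_continuous_onI[OF \<psi>_cont] by simp
    show "integrable lborel (\<lambda>y. B * indicator (cball 0 (\<rho> + norm v)) y)"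
      by (intro integrable_mult_right integrable_real_indicator emeasure_compact_finite) auto
    show "AE y in lborel. (\<lambda>n. ?s n y) \<longlonglongrightarrow> D y v"
    proof (rule AE_I2)
      fix y
      have "((\<lambda>h. (\<psi> ((0 + h) *\<^sub>R v + y) - \<psi> (0 *\<^sub>R v + y)) / h) \<longlongrightarrow> D (0 *\<^sub>R v + y) v) (at 0)"
        using line[of y 0] unfolding DERIV_def .
      then have "((\<lambda>h. (\<psi> (h *\<^sub>R v + y) - \<psi> y) / h) \<longlongrightarrow> D y v) (at 0)"
        by simp
      from filterlim_compose[OF this t_lim] show "(\<lambda>n. ?s n y) \<longlonglongrightarrow> D y v" .
    qed
    show "AE y in lborel. norm (?s n y) \<le> B * indicator (cball 0 (\<rho> + norm v)) y" for n
    proof (rule AE_I2)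
      fix y
      show "norm (?s n y) \<le> B * indicator (cball 0 (\<rho> + norm v)) y"
      proof (cases "y \<in> cball 0 (\<rho> + norm v)")
        case True
        \<comment> \<open>The quotient equals the directional derivative at an intermediate point,
          so \<open>B\<close> bounds it uniformly in \<open>n\<close>.\<close>
        obtain z where "\<psi> (t n *\<^sub>R v + y) - \<psi> (0 *\<^sub>R v + y) = (t n - 0) * D (z *\<^sub>R v + y) v"
          using MVT2[OF t(1)[of n], of "\<lambda>s. \<psi> (s *\<^sub>R v + y)" "\<lambda>s. D (s *\<^sub>R v + y) v"] line by blast
        then have "?s n y = D (z *\<^sub>R v + y) v"
          using t(1)[of n] by simp
        with B True show ?thesis by simp
      next
        case False
        \<comment> \<open>Outside the large ball neither \<open>y\<close> nor its shift can lie in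
          \<open>K\<close>, so the quotient vanishes.\<close>
        have "norm (t n *\<^sub>R v) \<le> 1 * norm v"
          unfolding norm_scaleR using t[of n] by (intro mult_right_mono) auto
        moreover have "norm y \<le> norm (t n *\<^sub>R v + y) + norm (t n *\<^sub>R v)"
          using norm_triangle_ineq4[of "t n *\<^sub>R v + y" "t n *\<^sub>R v"] by simp
        ultimately have "t n *\<^sub>R v + y \<notin> K" "y \<notin> K"
          using False \<rho>[of y] \<rho>[of "t n *\<^sub>R v + y"] norm_ge_zero[of v] by (auto simp: not_le)
        with K(2) B(1) show ?thesis by simp
      qed
    qed
  qed
  moreover have "(LINT y|lborel. ?s n y) = 0" for n
    using integral_lborel_shift[OF \<psi>_int, of "t n *\<^sub>R v"]
    by (simp add: Bochner_Integration.integral_diff[OF integrable_lborel_shift[OF \<psi>_int] \<psi>_int])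
  ultimately show ?thesis
    by (simp only: LIMSEQ_const_iff)
qed

section \<open>Local integrability and pairing with test functions\<close>

lemma open_sets_lebesgue: "open (\<Omega> :: 'a::euclidean_space set) \<Longrightarrow> \<Omega> \<inter> space lebesgue \<in> sets lebesgue"
  by simp

text \<open>On \<open>K\<close> the product is dominated by a multiple of \<open>u\<close>, which is
  integrable there; off \<open>K\<close> it vanishes, so extending by zero from \<open>K\<close> or
  from \<Omega> gives the same function.\<close>

lemma integrable_compact_support_mult:
  fixes u :: "'a::euclidean_space \<Rightarrow> 'b::{banach, second_countable_topology}"
  assumes \<Omega>: "open \<Omega>" and u: "locally_integrable \<Omega> u"
    and \<psi>: "continuous_on UNIV \<psi>"
    and K: "compact K" "K \<subseteq> \<Omega>" "\<And>y. y \<notin> K \<Longrightarrow> \<psi> y = 0"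
  shows "integrable (lebesgue_on \<Omega>) (\<lambda>x. \<psi> x *\<^sub>R u x)"
proof -
  obtain B where B: "0 \<le> B" "\<And>y. norm (\<psi> y) \<le> B"
    using bounded_compact_support[OF \<psi> K(1,3)] by metis
  have uK: "integrable (lebesgue_on K) u"
    using u K by (simp add: locally_integrable_def)
  have K_sets: "K \<in> sets lebesgue"
    using K(1) by (simp add: compact_imp_closed)
  have "integrable (lebesgue_on K) (\<lambda>x. \<psi> x *\<^sub>R u x)"
  proof (rule Bochner_Integration.integrable_bound)
    show "integrable (lebesgue_on K) (\<lambda>x. B *\<^sub>R u x)"
      using uK by simp
    have "\<psi> \<in> borel_measurable (lebesgue_on K)"
      using K_sets \<psi> by (intro continuous_imp_measurable_on_sets_lebesgue) (auto intro: continuous_on_subset)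
    then show "(\<lambda>x. \<psi> x *\<^sub>R u x) \<in> borel_measurable (lebesgue_on K)"
      using uK by (intro borel_measurable_scaleR) auto
    show "AE x in lebesgue_on K. norm (\<psi> x *\<^sub>R u x) \<le> norm (B *\<^sub>R u x)"
      using B by (intro AE_I2) (auto intro: mult_right_mono)
  qed
  then have "integrable lebesgue (\<lambda>x. indicator K x *\<^sub>R \<psi> x *\<^sub>R u x)"
    using K_sets by (subst (asm) integrable_restrict_space) auto
  also have "(\<lambda>x. indicator K x *\<^sub>R \<psi> x *\<^sub>R u x) = (\<lambda>x. indicator \<Omega> x *\<^sub>R \<psi> x *\<^sub>R u x)"
    using K(2,3) by (auto simp: indicator_def fun_eq_iff)
  finally show ?thesis
    using \<Omega> by (subst integrable_restrict_space) auto
qed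

text \<open>Moves integrals over \<Omega> to \<open>lborel\<close>, where translation invariance was
  used. Continuity makes \<open>f\<close> Borel measurable, so completing the measure does not
  change the integral.\<close>

lemma integral_lebesgue_on_compact_support:
  fixes f :: "'a::euclidean_space \<Rightarrow> 'b::{banach, second_countable_topology}"
  assumes "open \<Omega>" "continuous_on UNIV f" "\<And>y. y \<notin> \<Omega> \<Longrightarrow> f y = 0"
  shows "integral\<^sup>L (lebesgue_on \<Omega>) f = integral\<^sup>L lborel f"
proof -
  have "indicator \<Omega> x *\<^sub>R f x = f x" for x
    using assms(3)[of x] by (auto simp: indicator_def)
  moreover have "f \<in> borel_measurable lborel"
    using borel_measurable_continuous_onI[OF assms(2)] by simp
  ultimately show ?thesis
    using assms(1) by (simp add: integral_restrict_space integral_completion)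
qed

lemma continuous_imp_locally_integrable:
  assumes "continuous_on UNIV u"
  shows "locally_integrable \<Omega> u"
  unfolding locally_integrable_def
proof (intro allI impI, elim conjE)
  fix K :: "'a set"
  assume K: "compact K"
  have "integrable lborel (\<lambda>x. indicator K x *\<^sub>R u x)"
    by (rule borel_integrable_compact[OF K]) (use assms in \<open>auto intro: continuous_on_subset\<close>)
  then have "integrable lebesgue (\<lambda>x. indicator K x *\<^sub>R u x)"
    using borel_measurable_integrable by (subst integrable_completion) auto
  then show "integrable (lebesgue_on K) u"
    using K by (subst integrable_restrict_space) (auto simp: compact_imp_closed)
qed

lemma locally_integrable_diff:
  "locally_integrable \<Omega> u \<Longrightarrow> locally_integrable \<Omega> v \<Longrightarrow> locally_integrable \<Omega> (\<lambda>x. u x - v x)"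
  by (simp add: locally_integrable_def)

text \<open>Carries facts about basis directions, the only ones in the definitions of
  \<open>Ck\<close> and of weak gradients, over to any direction.\<close>

lemma linear_eq_sum_Basis:
  fixes f :: "'a::euclidean_space \<Rightarrow> real"
  assumes "linear f"
  shows "f v = (\<Sum>i\<in>Basis. (v \<bullet> i) * f i)"
proof -
  have "f v = f (\<Sum>i\<in>Basis. (v \<bullet> i) *\<^sub>R i)"
    by (simp only: euclidean_representation)
  then show ?thesis
    by (simp only: linear_sum[OF assms] linear_cmul[OF assms] real_scaleR_def)
qed

lemma
  assumes "test_function \<Omega> \<phi>"
  shows test_function_has_derivative: "(\<phi> has_derivative frechet_derivative \<phi> (at x)) (at x)"
    and test_function_continuous: "continuous_on UNIV \<phi>"
    and test_function_derivative_continuous: "continuous_on UNIV (\<lambda>x. frechet_derivative \<phi> (at x) v)"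
proof -
  have Ck: "Ck k \<phi>" for k
    using assms by (simp add: test_function_def)
  show der: "(\<phi> has_derivative frechet_derivative \<phi> (at x)) (at x)" for x
    by (rule Ck_SucD(1)[OF Ck])
  show "continuous_on UNIV \<phi>"
    using Ck[of 0] by simp
  note linear_eq_sum_Basis[OF has_derivative_linear[OF der], of _ v]
  moreover have "continuous_on UNIV (\<lambda>x. frechet_derivative \<phi> (at x) i)" if "i \<in> Basis" for i
    using Ck_SucD(2)[OF Ck[of "Suc 0"] that] by simp
  ultimately show "continuous_on UNIV (\<lambda>x. frechet_derivative \<phi> (at x) v)"
    by (auto intro!: continuous_intros)
qed

text \<open>The closed support serves as \<open>K\<close> for the function and for all its
  directional derivatives at once.\<close>

lemma test_function_support:
  assumes "test_function \<Omega> \<phi>"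
  obtains K where "compact K" "K \<subseteq> \<Omega>" "\<And>y. y \<notin> K \<Longrightarrow> \<phi> y = 0"
    "\<And>y v. y \<notin> K \<Longrightarrow> frechet_derivative \<phi> (at y) v = 0"
proof -
  define K where "K = closure {x. \<phi> x \<noteq> 0}"
  have K: "compact K" "K \<subseteq> \<Omega>"
    using assms by (auto simp: test_function_def K_def)
  have \<phi>: "\<phi> y = 0" if "y \<notin> K" for y
    using that closure_subset[of "{x. \<phi> x \<noteq> 0}"] by (auto simp: K_def)
  have "frechet_derivative \<phi> (at y) v = 0" if "y \<notin> K" for y v
    using has_derivative_eq_0_outside_support[OF test_function_has_derivative[OF assms]
        compact_imp_closed[OF K(1)] that \<phi>]
    by simp
  with K \<phi> show ?thesis
    by (rule that)
qed

lemma
  fixes u :: "'a::euclidean_space \<Rightarrow> 'b::{banach, second_countable_topology}"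
  assumes "open \<Omega>" "locally_integrable \<Omega> u" "test_function \<Omega> \<phi>"
  shows integrable_test_function: "integrable (lebesgue_on \<Omega>) (\<lambda>x. \<phi> x *\<^sub>R u x)"
    and integrable_test_function_derivative:
      "integrable (lebesgue_on \<Omega>) (\<lambda>x. frechet_derivative \<phi> (at x) v *\<^sub>R u x)"
proof -
  obtain K where K: "compact K" "K \<subseteq> \<Omega>" "\<And>y. y \<notin> K \<Longrightarrow> \<phi> y = 0"
    "\<And>y v. y \<notin> K \<Longrightarrow> frechet_derivative \<phi> (at y) v = 0"
    using test_function_support[OF assms(3)] by metis
  show "integrable (lebesgue_on \<Omega>) (\<lambda>x. \<phi> x *\<^sub>R u x)"
    using K(3) by (rule integrable_compact_support_mult[OF assms(1,2) test_function_continuous[OF assms(3)] K(1,2)])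
  show "integrable (lebesgue_on \<Omega>) (\<lambda>x. frechet_derivative \<phi> (at x) v *\<^sub>R u x)"
    using K(4) by (rule integrable_compact_support_mult[OF assms(1,2) test_function_derivative_continuous[OF assms(3)] K(1,2)])
qed

section \<open>Calculus of weak gradients\<close>

text \<open>The defining identity tests basis directions only; linearity in \<open>v\<close> extends
  it to every direction. The gradient estimate uses it in the direction of the classical gradient
  itself.\<close>

lemma
  assumes \<Omega>: "open \<Omega>" and g: "is_weak_gradient \<Omega> u g" and \<phi>: "test_function \<Omega> \<phi>"
  shows is_weak_gradient_integrable:
      "integrable (lebesgue_on \<Omega>) (\<lambda>x. u x * frechet_derivative \<phi> (at x) v)"
      "integrable (lebesgue_on \<Omega>) (\<lambda>x. inner (g x) v * \<phi> x)"
    and is_weak_gradient_directional: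
      "(LINT x|lebesgue_on \<Omega>. u x * frechet_derivative \<phi> (at x) v) =
        - (LINT x|lebesgue_on \<Omega>. inner (g x) v * \<phi> x)"
proof -
  show int_u: "integrable (lebesgue_on \<Omega>) (\<lambda>x. u x * frechet_derivative \<phi> (at x) v)" for v
    using integrable_test_function_derivative[OF \<Omega> _ \<phi>, of u v] g
    by (simp add: is_weak_gradient_def mult.commute)
  have "integrable (lebesgue_on \<Omega>) (\<lambda>x. inner (\<phi> x *\<^sub>R g x) v)" for v
    using integrable_test_function[OF \<Omega> _ \<phi>, of g] g
    by (intro integrable_inner_left) (simp add: is_weak_gradient_def)
  then show int_g: "integrable (lebesgue_on \<Omega>) (\<lambda>x. inner (g x) v * \<phi> x)" for v
    by (simp add: mult.commute)
  have "frechet_derivative \<phi> (at x) v = (\<Sum>i\<in>Basis. (v \<bullet> i) * frechet_derivative \<phi> (at x) i)" for x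
    by (rule linear_eq_sum_Basis[OF has_derivative_linear[OF test_function_has_derivative[OF \<phi>]]])
  then have "(LINT x|lebesgue_on \<Omega>. u x * frechet_derivative \<phi> (at x) v) =
      (LINT x|lebesgue_on \<Omega>. (\<Sum>i\<in>Basis. (v \<bullet> i) * (u x * frechet_derivative \<phi> (at x) i)))"
    by (simp add: sum_distrib_left ac_simps)
  also have "\<dots> = (\<Sum>i\<in>Basis. (v \<bullet> i) * (LINT x|lebesgue_on \<Omega>. u x * frechet_derivative \<phi> (at x) i))"
    using int_u by (subst Bochner_Integration.integral_sum) auto
  also have "\<dots> = (\<Sum>i\<in>Basis. (v \<bullet> i) * - (LINT x|lebesgue_on \<Omega>. inner (g x) i * \<phi> x))"
    using g \<phi> by (intro sum.cong) (auto simp: is_weak_gradient_def)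
  also have "\<dots> = - (LINT x|lebesgue_on \<Omega>. (\<Sum>i\<in>Basis. (v \<bullet> i) * (inner (g x) i * \<phi> x)))"
    using int_g by (subst Bochner_Integration.integral_sum) (auto simp: sum_negf)
  also have "(\<lambda>x. \<Sum>i\<in>Basis. (v \<bullet> i) * (inner (g x) i * \<phi> x)) = (\<lambda>x. inner (g x) v * \<phi> x)"
    by (rule ext, subst euclidean_inner[of "g _" v]) (simp only: sum_distrib_left sum_distrib_right ac_simps)
  finally show "(LINT x|lebesgue_on \<Omega>. u x * frechet_derivative \<phi> (at x) v) =
        - (LINT x|lebesgue_on \<Omega>. inner (g x) v * \<phi> x)" .
qed

lemma is_weak_gradient_diff:
  assumes \<Omega>: "open \<Omega>" and g: "is_weak_gradient \<Omega> u g" and h: "is_weak_gradient \<Omega> v h"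
  shows "is_weak_gradient \<Omega> (\<lambda>x. u x - v x) (\<lambda>x. g x - h x)"
  unfolding is_weak_gradient_def
proof (intro conjI allI impI ballI)
  show "locally_integrable \<Omega> (\<lambda>x. u x - v x)"
    using g h by (intro locally_integrable_diff) (simp_all add: is_weak_gradient_def)
  show "locally_integrable \<Omega> (\<lambda>x. g x - h x)"
    using g h by (intro locally_integrable_diff) (simp_all add: is_weak_gradient_def)
  fix \<phi> :: "'a \<Rightarrow> real" and i :: 'a
  assume \<phi>: "test_function \<Omega> \<phi>"
  show "(LINT x|lebesgue_on \<Omega>. (u x - v x) * frechet_derivative \<phi> (at x) i) =
      - (LINT x|lebesgue_on \<Omega>. inner (g x - h x) i * \<phi> x)"
    using is_weak_gradient_integrable[OF \<Omega> g \<phi>] is_weak_gradient_integrable[OF \<Omega> h \<phi>]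
      is_weak_gradient_directional[OF \<Omega> g \<phi>, of i] is_weak_gradient_directional[OF \<Omega> h \<phi>, of i]
    by (simp add: left_diff_distrib inner_diff_left)
qed

text \<open>Integration by parts: the directional derivative of the affine function times \<phi> has
  integral zero, and the product rule splits it into the two sides of the identity.\<close>

lemma is_weak_gradient_affine:
  assumes \<Omega>: "open \<Omega>"
  shows "is_weak_gradient \<Omega> (\<lambda>y. c + (y - x) \<bullet> a) (\<lambda>_. a)"
  unfolding is_weak_gradient_def
proof (intro conjI allI impI ballI)
  show "locally_integrable \<Omega> (\<lambda>y. c + (y - x) \<bullet> a)" "locally_integrable \<Omega> (\<lambda>_. a)"
    by (rule continuous_imp_locally_integrable, intro continuous_intros)+
  fix \<phi> :: "'a \<Rightarrow> real" and i :: 'a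
  assume \<phi>: "test_function \<Omega> \<phi>"
  obtain K where K: "compact K" "K \<subseteq> \<Omega>" "\<And>y. y \<notin> K \<Longrightarrow> \<phi> y = 0"
    "\<And>y v. y \<notin> K \<Longrightarrow> frechet_derivative \<phi> (at y) v = 0"
    using test_function_support[OF \<phi>] by metis
  note cont = test_function_continuous[OF \<phi>] test_function_derivative_continuous[OF \<phi>, of i]
  let ?L = "\<lambda>y. c + (y - x) \<bullet> a"
  let ?D = "\<lambda>y h. ?L y * frechet_derivative \<phi> (at y) h + (h \<bullet> a) * \<phi> y"
  have "((\<lambda>y. ?L y * \<phi> y) has_derivative ?D y) (at y)" for y
    by (rule has_derivative_mult[OF _ test_function_has_derivative[OF \<phi>]])
      (auto intro!: derivative_eq_intros)
  then have "(LINT y|lborel. ?D y i) = 0"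
    by (rule integral_directional_derivative_eq_0[OF _ _ K(1)])
      (use K(3) in \<open>auto intro!: continuous_intros cont\<close>)
  moreover have "integrable lborel (\<lambda>y. ?L y * frechet_derivative \<phi> (at y) i)"
    by (rule integrable_lborel_compact_support[OF _ K(1)]) (use K(4) in \<open>auto intro!: continuous_intros cont\<close>)
  moreover have "integrable lborel (\<lambda>y. (i \<bullet> a) * \<phi> y)"
    by (rule integrable_lborel_compact_support[OF _ K(1)]) (use K(3) in \<open>auto intro!: continuous_intros cont\<close>)
  ultimately have "(LINT y|lborel. ?L y * frechet_derivative \<phi> (at y) i) = - (LINT y|lborel. (i \<bullet> a) * \<phi> y)"
    by (subst (asm) Bochner_Integration.integral_add) auto
  moreover have "(LINT y|lebesgue_on \<Omega>. ?L y * frechet_derivative \<phi> (at y) i) =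
      (LINT y|lborel. ?L y * frechet_derivative \<phi> (at y) i)"
    by (rule integral_lebesgue_on_compact_support[OF \<Omega>])
      (use K(2,4) in \<open>auto intro!: continuous_intros cont\<close>)
  moreover have "(LINT y|lebesgue_on \<Omega>. (i \<bullet> a) * \<phi> y) = (LINT y|lborel. (i \<bullet> a) * \<phi> y)"
    by (rule integral_lebesgue_on_compact_support[OF \<Omega>])
      (use K(2,3) in \<open>auto intro!: continuous_intros cont\<close>)
  ultimately show "(LINT y|lebesgue_on \<Omega>. ?L y * frechet_derivative \<phi> (at y) i) =
      - (LINT y|lebesgue_on \<Omega>. a \<bullet> i * \<phi> y)"
    by (simp only: inner_commute[of a i])
qed

section \<open>The classical gradient is bounded by the weak one\<close>

text \<open>The constants come from \<open>bump x r \<ge> exp (- 4 / 3)\<close> on the ball of radius \<open>r / 2\<close>, whose volume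
  is \<open>2\<close> to the power \<open>- DIM('a)\<close> times that of the support; the radius itself cancels.\<close>

lemma weak_gradient_bound_approx:
  fixes u :: "'a::euclidean_space \<Rightarrow> real"
  assumes \<Omega>: "open \<Omega>" "x \<in> \<Omega>" and u: "GDERIV u x :> a"
    and g: "is_weak_gradient \<Omega> u g" and AE: "AE y in lebesgue_on \<Omega>. norm (g y) \<le> \<epsilon>"
    and "0 < \<eta>"
  shows "((norm a)\<^sup>2 - \<epsilon> * norm a) * exp (- (4 / 3)) \<le> \<eta> * (4 * norm a * 2 ^ DIM('a))"
    (is "?E * _ \<le> _")
proof (cases "0 \<le> ?E")
  \<comment> \<open>Only a nonnegative \<open>?E\<close> preserves the lower bound on the bump under
    multiplication; for a negative one the left-hand side is already at most 0.\<close>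
  case True
  obtain R where R: "0 < R" "cball x R \<subseteq> \<Omega>"
    using \<Omega> open_contains_cball by blast
  obtain \<delta> where \<delta>: "0 < \<delta>" "\<And>y. norm (y - x) < \<delta> \<Longrightarrow> \<bar>u y - u x - (y - x) \<bullet> a\<bar> \<le> \<eta> * norm (y - x)"
    using u \<open>0 < \<eta>\<close> unfolding gderiv_def has_derivative_at_alt by fastforce
  \<comment> \<open>Halving \<delta> makes \<open>r\<close> strictly smaller than \<delta>, so the
    Taylor estimate holds on the whole closed ball.\<close>
  define r where "r = min R (\<delta> / 2)"
  have r: "0 < r" "r < \<delta>" "cball x r \<subseteq> \<Omega>"
    using R \<delta>(1) by (auto simp: r_def)
  let ?\<phi> = "bump x r" and ?w = "\<lambda>y. u y - (u x + (y - x) \<bullet> a)"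
  have \<phi>: "test_function \<Omega> ?\<phi>"
    by (rule test_function_bump) (use r in auto)
  \<comment> \<open>Subtracting the Taylor polynomial makes the function small near \<open>x\<close>
    and shifts its weak gradient by \<open>a\<close>.\<close>
  have w: "is_weak_gradient \<Omega> ?w (\<lambda>y. g y - a)"
    by (rule is_weak_gradient_diff[OF \<Omega>(1) g is_weak_gradient_affine[OF \<Omega>(1)]])
  have "locally_integrable \<Omega> (\<lambda>_. 1 :: real)"
    by (rule continuous_imp_locally_integrable) simp
  from integrable_test_function[OF \<Omega>(1) this \<phi>] have \<phi>_int: "integrable (lebesgue_on \<Omega>) ?\<phi>"
    by simp
  have balls: "integrable (lebesgue_on \<Omega>) (indicator (cball x s) :: 'a \<Rightarrow> real)"
    "integral\<^sup>L (lebesgue_on \<Omega>) (indicator (cball x s)) = unit_ball_vol DIM('a) * s ^ DIM('a)"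
    if "0 \<le> s" "s \<le> r" for s
  proof -
    have sub: "cball x s \<subseteq> \<Omega>"
      using r(3) that by (meson dual_order.trans subset_cball)
    have sets: "cball x s \<in> sets (lebesgue_on \<Omega>)"
      using sub \<Omega>(1) by (subst sets_restrict_space_iff) auto
    have "emeasure (lebesgue_on \<Omega>) (cball x s) < \<infinity>"
      using sub \<Omega>(1) emeasure_compact_finite[OF compact_cball]
      by (subst emeasure_restrict_space) auto
    then show "integrable (lebesgue_on \<Omega>) (indicator (cball x s) :: 'a \<Rightarrow> real)"
      using sets by (intro integrable_real_indicator)
    have "integral\<^sup>L (lebesgue_on \<Omega>) (indicator (cball x s)) = measure (lebesgue_on \<Omega>) (cball x s)"
      using sub by (simp add: Int_absorb2)
    also have "\<dots> = measure lborel (cball x s)"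
      using sub \<Omega>(1) by (subst measure_restrict_space) auto
    finally show "integral\<^sup>L (lebesgue_on \<Omega>) (indicator (cball x s)) = unit_ball_vol DIM('a) * s ^ DIM('a)"
      by (simp add: content_cball[OF that(1)])
  qed
  let ?V = "unit_ball_vol DIM('a) * r ^ DIM('a)"
  have "?E * (exp (- (4 / 3)) * (unit_ball_vol DIM('a) * (r / 2) ^ DIM('a))) =
      ?E * (LINT y|lebesgue_on \<Omega>. exp (- (4 / 3)) * indicator (cball x (r / 2)) y)"
    using balls(2)[of "r / 2"] r(1) by simp
  also have "\<dots> \<le> ?E * (LINT y|lebesgue_on \<Omega>. ?\<phi> y)"
  proof (rule mult_left_mono[OF _ True], rule integral_mono[OF _ \<phi>_int])
    show "integrable (lebesgue_on \<Omega>) (\<lambda>y. exp (- (4 / 3)) * indicator (cball x (r / 2)) y :: real)"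
      using balls(1)[of "r / 2"] r(1) by simp
    show "exp (- (4 / 3)) * indicator (cball x (r / 2)) y \<le> ?\<phi> y" for y
      using bump_ge[OF r(1), of y x] bump_nonneg[of x r y] by (simp split: split_indicator)
  qed
  also have "\<dots> = (LINT y|lebesgue_on \<Omega>. ?E * ?\<phi> y)"
    by simp
  \<comment> \<open>Cauchy-Schwarz gives \<open>g y \<bullet> a \<le> \<epsilon> * norm a\<close>
    almost everywhere, so \<open>?E\<close> lies below
    \<open>- ((g y - a) \<bullet> a)\<close>.\<close>
  also have "\<dots> \<le> (LINT y|lebesgue_on \<Omega>. - ((g y - a) \<bullet> a * ?\<phi> y))"
  proof (rule integral_mono_AE)
    show "integrable (lebesgue_on \<Omega>) (\<lambda>y. ?E * ?\<phi> y)"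
      using \<phi>_int by simp
    show "integrable (lebesgue_on \<Omega>) (\<lambda>y. - ((g y - a) \<bullet> a * ?\<phi> y))"
      using is_weak_gradient_integrable(2)[OF \<Omega>(1) w \<phi>] by simp
    show "AE y in lebesgue_on \<Omega>. ?E * ?\<phi> y \<le> - ((g y - a) \<bullet> a * ?\<phi> y)"
      using AE
    proof eventually_elim
      case (elim y)
      have "g y \<bullet> a \<le> \<epsilon> * norm a"
        using norm_cauchy_schwarz[of "g y" a] mult_right_mono[OF elim, of "norm a"] by simp
      then have "?E \<le> - ((g y - a) \<bullet> a)"
        by (simp add: inner_diff_left power2_norm_eq_inner)
      from mult_right_mono[OF this bump_nonneg] show ?case by simp
    qed
  qed
  also have "\<dots> = (LINT y|lebesgue_on \<Omega>. ?w y * frechet_derivative ?\<phi> (at y) a)"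
    using is_weak_gradient_directional[OF \<Omega>(1) w \<phi>, of a] by simp
  \<comment> \<open>The remainder is at most \<open>\<eta> * r\<close> on the ball and the
    derivative of the bump at most \<open>4 * norm a / r\<close>; the radius drops out of the
    product.\<close>
  also have "\<dots> \<le> (LINT y|lebesgue_on \<Omega>. 4 * \<eta> * norm a * indicator (cball x r) y)"
  proof (rule integral_mono[OF is_weak_gradient_integrable(1)[OF \<Omega>(1) w \<phi>]])
    show "integrable (lebesgue_on \<Omega>) (\<lambda>y. 4 * \<eta> * norm a * indicator (cball x r) y :: real)"
      using balls(1)[of r] r(1) by simp
    fix y
    have "?w y * frechet_derivative ?\<phi> (at y) a \<le> \<bar>?w y\<bar> * (4 * norm a / r * indicator (cball x r) y)"
      using mult_left_mono[OF frechet_derivative_bump_le[OF r(1), of x y a] abs_ge_zero[of "?w y"]]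
      unfolding abs_mult[symmetric] by (rule order_trans[OF abs_ge_self])
    also have "\<dots> \<le> (\<eta> * r) * (4 * norm a / r * indicator (cball x r) y)"
    proof (cases "y \<in> cball x r")
      case True
      then have "norm (y - x) \<le> r"
        by (simp add: dist_norm norm_minus_commute)
      then have "\<bar>u y - u x - (y - x) \<bullet> a\<bar> \<le> \<eta> * r"
        using \<delta>(2)[of y] r(2) mult_left_mono[of "norm (y - x)" r \<eta>] \<open>0 < \<eta>\<close> by linarith
      then have "\<bar>?w y\<bar> \<le> \<eta> * r"
        by (simp only: diff_diff_eq)
      then show ?thesis
        using r(1) by (intro mult_right_mono) auto
    qed simp
    also have "\<dots> = 4 * \<eta> * norm a * indicator (cball x r) y"
      using r(1) by simp
    finally show "?w y * frechet_derivative ?\<phi> (at y) a \<le> 4 * \<eta> * norm a * indicator (cball x r) y" .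
  qed
  also have "\<dots> = 4 * \<eta> * norm a * ?V"
    using balls(2)[of r] r(1) by simp
  finally have "?E * exp (- (4 / 3)) * ?V \<le> \<eta> * (4 * norm a * 2 ^ DIM('a)) * ?V"
    by (simp add: power_divide field_simps)
  moreover have "0 < ?V"
    using r(1) by (simp add: unit_ball_vol_pos)
  ultimately show ?thesis
    by (rule mult_right_le_imp_le)
next
  case False
  then have "?E * exp (- (4 / 3)) \<le> 0"
    by (intro mult_nonpos_nonneg) auto
  also have "0 \<le> \<eta> * (4 * norm a * 2 ^ DIM('a))"
    using \<open>0 < \<eta>\<close> by simp
  finally show ?thesis .
qed

text \<open>Letting \<eta> tend to 0 in the approximate bound leaves
  \<open>norm a * norm a \<le> \<epsilon> * norm a\<close>, which can be divided by
  \<open>norm a\<close> unless \<open>a = 0\<close>.\<close>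

lemma norm_gderiv_le_weak_gradient:
  fixes u :: "'a::euclidean_space \<Rightarrow> real"
  assumes "open \<Omega>" "x \<in> \<Omega>" "GDERIV u x :> a"
    and "is_weak_gradient \<Omega> u g" "AE y in lebesgue_on \<Omega>. norm (g y) \<le> \<epsilon>" "0 \<le> \<epsilon>"
  shows "norm a \<le> \<epsilon>"
proof (cases "a = 0")
  case False
  let ?E = "((norm a)\<^sup>2 - \<epsilon> * norm a) * exp (- (4 / 3))" and ?M = "4 * norm a * 2 ^ DIM('a)"
  have M: "0 < ?M"
    using False by simp
  have "?E \<le> 0 + e" if "0 < e" for e
  proof -
    \<comment> \<open>The choice \<open>\<eta> = e / ?M\<close> makes the right-hand side equal to
      \<open>e\<close>.\<close>
    have "?E \<le> e / ?M * ?M"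
      by (rule weak_gradient_bound_approx[OF assms(1-5)]) (use that M in simp)
    also have "e / ?M * ?M = 0 + e"
      using False by simp
    finally show ?thesis .
  qed
  then have "?E \<le> 0"
    by (rule field_le_epsilon)
  then have "norm a * norm a \<le> \<epsilon> * norm a"
    by (simp add: mult_le_0_iff power2_eq_square)
  with False show ?thesis by simp
qed (use assms(6) in simp)

section \<open>From almost-everywhere bounds to pointwise ones, and norms to bounds\<close>

text \<open>The set of points of \<Omega> where \<open>h\<close> exceeds \<open>c\<close> is open.
  Its complement is a closed set containing almost every point of \<Omega>, hence all of
  \<Omega>.\<close>

lemma AE_le_imp_le_on_open:
  fixes h :: "'a::euclidean_space \<Rightarrow> real"
  assumes "open \<Omega>" "continuous_on \<Omega> h" "AE y in lebesgue_on \<Omega>. h y \<le> c" "x \<in> \<Omega>"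
  shows "h x \<le> c"
proof -
  have "open (h -` {c<..} \<inter> \<Omega>)"
    using assms(1,2) by (simp add: continuous_on_open_vimage)
  then have "closed (- (h -` {c<..} \<inter> \<Omega>))"
    by (rule closed_Compl)
  moreover have "AE y \<in> \<Omega> in lebesgue. y \<in> - (h -` {c<..} \<inter> \<Omega>)"
    using assms(3) unfolding AE_restrict_space_iff[OF open_sets_lebesgue[OF assms(1)]]
    by eventually_elim auto
  ultimately have "x \<in> - (h -` {c<..} \<inter> \<Omega>)"
    by (rule mem_closed_if_AE_lebesgue_open[OF assms(1) _ _ assms(4)])
  with assms(4) show ?thesis by auto
qed

lemma AE_norm_le_Linf_norm:
  assumes "Linf_norm \<Omega> u \<le> ennreal c" "0 \<le> c"
  shows "AE x in lebesgue_on \<Omega>. norm (u x) \<le> c"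
  using esssup_AE[of "\<lambda>x. ennreal (norm (u x))" "lebesgue_on \<Omega>"]
proof eventually_elim
  case (elim x)
  with assms(1) have "ennreal (norm (u x)) \<le> ennreal c"
    by (simp add: Linf_norm_def)
  with assms(2) show ?case
    by (simp add: ennreal_le_iff)
qed

text \<open>The difference of the two weak gradients is a witness, so the choice in
  \<open>weak_grad\<close> returns a genuine weak gradient.\<close>

lemma is_weak_gradient_weak_grad:
  assumes "open \<Omega>" "u \<in> W1inf \<Omega>" "v \<in> W1inf \<Omega>"
  shows "is_weak_gradient \<Omega> (\<lambda>x. u x - v x) (weak_grad \<Omega> (\<lambda>x. u x - v x))"
proof -
  obtain g h where "is_weak_gradient \<Omega> u g" "is_weak_gradient \<Omega> v h"
    using assms by (auto simp: W1inf_def)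
  from is_weak_gradient_diff[OF assms(1) this] show ?thesis
    unfolding weak_grad_def by (rule someI[where P = "is_weak_gradient \<Omega> (\<lambda>x. u x - v x)"])
qed

section \<open>Termwise differentiation\<close>

text \<open>The theorem \<open>has_derivative_sequence\<close> works on convex sets, so it is
  applied on a ball around \<open>x\<close>. The limit function it produces agrees there with
  \<open>F\<close> by uniqueness of limits.\<close>

lemma gderiv_uniform_limit:
  fixes f :: "nat \<Rightarrow> 'a::euclidean_space \<Rightarrow> real"
  assumes \<Omega>: "open \<Omega>" "x \<in> \<Omega>"
    and der: "\<And>n x. x \<in> \<Omega> \<Longrightarrow> GDERIV (f n) x :> G' n x"
    and F: "\<And>x. x \<in> \<Omega> \<Longrightarrow> (\<lambda>n. f n x) \<longlonglongrightarrow> F x"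
    and G: "uniform_limit \<Omega> G' G sequentially"
  shows "GDERIV F x :> G x"
proof -
  obtain r where r: "0 < r" "ball x r \<subseteq> \<Omega>"
    using \<Omega> open_contains_ball by blast
  have "\<exists>g. \<forall>y\<in>ball x r. (\<lambda>n. f n y) \<longlonglongrightarrow> g y \<and>
      (g has_derivative (\<lambda>h. h \<bullet> G y)) (at y within ball x r)"
  proof (rule has_derivative_sequence)
    show "(f n has_derivative (\<lambda>h. h \<bullet> G' n y)) (at y within ball x r)" if "y \<in> ball x r" for n y
      using der[of y n] that r(2)
      by - (rule has_derivative_at_withinI, auto simp: gderiv_def)
    show "\<forall>\<^sub>F n in sequentially. \<forall>y\<in>ball x r. \<forall>h. norm (h \<bullet> G' n y - h \<bullet> G y) \<le> e * norm h"
      if "0 < e" for e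
      using uniform_limitD[OF G that]
    proof eventually_elim
      case (elim n)
      have "norm (h \<bullet> G' n y - h \<bullet> G y) \<le> e * norm h" if "y \<in> ball x r" for y h
      proof -
        have "norm (G' n y - G y) \<le> e"
          using bspec[OF elim subsetD[OF r(2) that]] by (simp add: dist_norm)
        from mult_right_mono[OF this, of "norm h"] show ?thesis
          using Cauchy_Schwarz_ineq2[of h "G' n y - G y"]
          by (simp add: inner_diff_right mult.commute)
      qed
      then show ?case by blast
    qed
    show "x \<in> ball x r" "(\<lambda>n. f n x) \<longlonglongrightarrow> F x"
      using r F[OF \<Omega>(2)] by auto
  qed simp
  then obtain g where g: "\<And>y. y \<in> ball x r \<Longrightarrow> (\<lambda>n. f n y) \<longlonglongrightarrow> g y"
      "(g has_derivative (\<lambda>h. h \<bullet> G x)) (at x within ball x r)"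
    using r(1) by (meson centre_in_ball)
  have "g y = F y" if "y \<in> ball x r" for y
    using LIMSEQ_unique[OF g(1)[OF that] F] that r(2) by auto
  moreover have "x \<in> ball x r"
    using r(1) by simp
  moreover from this have "(g has_derivative (\<lambda>h. h \<bullet> G x)) (at x)"
    using g(2) by (simp add: at_within_open[OF _ open_ball])
  ultimately show ?thesis
    unfolding gderiv_def by (metis has_derivative_transform_within_open open_ball)
qed

section \<open>Uniform Cauchy property and identification of the limit\<close>

theorem corollary2:
  fixes \<Omega> :: "(real ^ 'd) set"
    and f :: "nat \<Rightarrow> real ^ 'd \<Rightarrow> real"
    and f_lim :: "real ^ 'd \<Rightarrow> real"
  assumes "open \<Omega>"
    and "\<And>k x. x \<in> \<Omega> \<Longrightarrow> f k differentiable (at x)"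
    and "\<And>k. f k \<in> W1inf \<Omega>"
    and "f_lim \<in> W1inf \<Omega>"
    and "W1inf_tendsto \<Omega> f f_lim"
  shows "(\<exists>g. continuous_representative \<Omega> f_lim g) \<and>
    (\<forall>g. continuous_representative \<Omega> f_lim g \<longrightarrow>
      (\<forall>x\<in>\<Omega>. g differentiable (at x)) \<and>
      uniform_limit \<Omega> f g sequentially \<and>
      uniform_limit \<Omega> (\<lambda>k. grad (f k)) (grad g) sequentially)"
proof -
  note \<Omega> = \<open>open \<Omega>\<close>
  have der: "GDERIV (f k) x :> grad (f k) x" if "x \<in> \<Omega>" for k x
    by (rule gderiv_grad[OF assms(2)[OF that]])
  have f_cont: "continuous_on \<Omega> (f k)" for k
    using differentiable_imp_continuous_within[OF assms(2)]
    by (simp add: continuous_on_eq_continuous_at[OF \<Omega>])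
  let ?W = "\<lambda>k. weak_grad \<Omega> (\<lambda>x. f k x - f_lim x)"
  have close: "\<exists>N. \<forall>k\<ge>N. (AE x in lebesgue_on \<Omega>. \<bar>f k x - f_lim x\<bar> \<le> e) \<and>
      (AE x in lebesgue_on \<Omega>. norm (?W k x) \<le> e)" if "0 < e" for e
  proof -
    have "(\<lambda>k. W1inf_norm \<Omega> (\<lambda>x. f k x - f_lim x)) \<longlonglongrightarrow> 0"
      using assms(5) by (simp add: W1inf_tendsto_def)
    from order_tendstoD(2)[OF this, of "ennreal e"] that
    obtain N where N: "\<And>k. N \<le> k \<Longrightarrow> W1inf_norm \<Omega> (\<lambda>x. f k x - f_lim x) < ennreal e"
      by (auto simp: eventually_sequentially)
    have "(AE x in lebesgue_on \<Omega>. \<bar>f k x - f_lim x\<bar> \<le> e) \<and>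
        (AE x in lebesgue_on \<Omega>. norm (?W k x) \<le> e)" if "N \<le> k" for k
    proof -
      have "Linf_norm \<Omega> (\<lambda>x. f k x - f_lim x) \<le> W1inf_norm \<Omega> (\<lambda>x. f k x - f_lim x)"
        "Linf_norm \<Omega> (?W k) \<le> W1inf_norm \<Omega> (\<lambda>x. f k x - f_lim x)"
        by (simp_all add: W1inf_norm_def)
      from this[THEN order_trans, OF less_imp_le[OF N[OF that]]] show ?thesis
        using AE_norm_le_Linf_norm[of \<Omega> "\<lambda>x. f k x - f_lim x" e] AE_norm_le_Linf_norm[of \<Omega> "?W k" e] \<open>0 < e\<close>
        by simp
    qed
    then show ?thesis by blast
  qed
  \<comment> \<open>Two members of the sequence are compared with each other, since the gradient
    estimate requires classical differentiability, which is not yet known for the limit.\<close>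
  have cauchy: "\<exists>N. \<forall>m\<ge>N. \<forall>n\<ge>N. \<forall>x\<in>\<Omega>. \<bar>f m x - f n x\<bar> \<le> e \<and> norm (grad (f m) x - grad (f n) x) \<le> e"
    if "0 < e" for e
  proof -
    obtain N where N: "\<And>k. N \<le> k \<Longrightarrow> AE x in lebesgue_on \<Omega>. \<bar>f k x - f_lim x\<bar> \<le> e / 2"
      "\<And>k. N \<le> k \<Longrightarrow> AE x in lebesgue_on \<Omega>. norm (?W k x) \<le> e / 2"
      using close[of "e / 2"] \<open>0 < e\<close> by auto
    have "\<bar>f m x - f n x\<bar> \<le> e" "norm (grad (f m) x - grad (f n) x) \<le> e"
      if mn: "N \<le> m" "N \<le> n" and x: "x \<in> \<Omega>" for m n x
    proof -
      show "\<bar>f m x - f n x\<bar> \<le> e"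
      proof (rule AE_le_imp_le_on_open[OF \<Omega> _ _ x])
        show "AE x in lebesgue_on \<Omega>. \<bar>f m x - f n x\<bar> \<le> e"
          using N(1)[OF mn(1)] N(1)[OF mn(2)] by eventually_elim linarith
      qed (intro continuous_intros f_cont)
      \<comment> \<open>The limit cancels, which exhibits a weak gradient of
        \<open>f m - f n\<close> as a difference of two weak gradients bounded by
        \<open>e / 2\<close>.\<close>
      have "is_weak_gradient \<Omega> (\<lambda>x. (f m x - f_lim x) - (f n x - f_lim x)) (\<lambda>x. ?W m x - ?W n x)"
        by (intro is_weak_gradient_diff[OF \<Omega>] is_weak_gradient_weak_grad[OF \<Omega>] assms(3,4))
      then have weak: "is_weak_gradient \<Omega> (\<lambda>x. f m x - f n x) (\<lambda>x. ?W m x - ?W n x)"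
        by simp
      have "GDERIV (\<lambda>x. f m x - f n x) x :> grad (f m) x - grad (f n) x"
        by (intro GDERIV_diff der x)
      moreover have "AE x in lebesgue_on \<Omega>. norm (?W m x - ?W n x) \<le> e"
        using N(2)[OF mn(1)] N(2)[OF mn(2)]
      proof eventually_elim
        case (elim y)
        then show ?case
          using norm_triangle_ineq4[of "?W m y" "?W n y"] by linarith
      qed
      ultimately show "norm (grad (f m) x - grad (f n) x) \<le> e"
        using norm_gderiv_le_weak_gradient[OF \<Omega> x _ weak] \<open>0 < e\<close> by simp
    qed
    then show ?thesis by blast
  qed
  have "\<exists>N. \<forall>m\<ge>N. \<forall>n\<ge>N. \<forall>x\<in>\<Omega>. dist (f m x) (f n x) < e \<and> dist (grad (f m) x) (grad (f n) x) < e"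
    if "0 < e" for e
  proof -
    have "0 < e / 2" "e / 2 < e"
      using that by auto
    then show ?thesis
      using cauchy[of "e / 2"] unfolding dist_norm real_norm_def by (meson order_le_less_trans)
  qed
  then have "uniformly_Cauchy_on \<Omega> f" "uniformly_Cauchy_on \<Omega> (\<lambda>k. grad (f k))"
    unfolding uniformly_Cauchy_on_def by meson+
  then obtain F G where F: "uniform_limit \<Omega> f F sequentially"
    and G: "uniform_limit \<Omega> (\<lambda>k. grad (f k)) G sequentially"
    unfolding uniformly_convergent_eq_Cauchy[symmetric] uniformly_convergent_on_def by blast
  have F_cont: "continuous_on \<Omega> F"
    by (rule uniform_limit_theorem[OF always_eventually F]) (auto intro: f_cont)
  have F_der: "GDERIV F x :> G x" if "x \<in> \<Omega>" for x
    by (rule gderiv_uniform_limit[OF \<Omega> that der tendsto_uniform_limitI[OF F] G])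
  \<comment> \<open>Using only the bounds \<open>1 / (j + 1)\<close> keeps the exceptional sets
    countable in number, so their union is null and \<open>F = f_lim\<close> holds almost
    everywhere.\<close>
  have "AE x in lebesgue_on \<Omega>. \<forall>j. \<bar>F x - f_lim x\<bar> \<le> inverse (real (Suc j))"
  proof (rule AE_all_countable[THEN iffD2], intro allI)
    fix j
    let ?e = "inverse (real (Suc j)) / 2"
    obtain N where N: "\<And>k. N \<le> k \<Longrightarrow> AE x in lebesgue_on \<Omega>. \<bar>f k x - f_lim x\<bar> \<le> ?e"
      using close[of ?e] by auto
    obtain M where M: "\<And>k x. M \<le> k \<Longrightarrow> x \<in> \<Omega> \<Longrightarrow> dist (f k x) (F x) < ?e"
      using uniform_limitD[OF F, of ?e] by (auto simp: eventually_sequentially)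
    have "AE x in lebesgue_on \<Omega>. x \<in> \<Omega>"
      using AE_space[of "lebesgue_on \<Omega>"] by (simp add: space_restrict_space)
    with N[of "max M N", OF max.cobounded2]
    show "AE x in lebesgue_on \<Omega>. \<bar>F x - f_lim x\<bar> \<le> inverse (real (Suc j))"
    proof eventually_elim
      case (elim x)
      with M[of "max M N" x] show ?case
        unfolding dist_real_def by linarith
    qed
  qed
  then have F_eq: "AE x in lebesgue_on \<Omega>. F x = f_lim x"
  proof eventually_elim
    case (elim x)
    have "\<bar>F x - f_lim x\<bar> \<le> 0"
      by (rule LIMSEQ_le_const[OF LIMSEQ_inverse_real_of_nat]) (use elim in auto)
    then show ?case by simp
  qed
  \<comment> \<open>Two continuous functions that agree almost everywhere on an open set agree
    everywhere on it, so what is shown for \<open>F\<close> applies to every continuous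
    representative.\<close>
  have unique: "g x = F x" if g: "continuous_representative \<Omega> f_lim g" and x: "x \<in> \<Omega>" for g x
  proof -
    have "\<bar>g x - F x\<bar> \<le> 0"
    proof (rule AE_le_imp_le_on_open[OF \<Omega> _ _ x])
      show "continuous_on \<Omega> (\<lambda>x. \<bar>g x - F x\<bar>)"
        using g F_cont by (auto simp: continuous_representative_def intro!: continuous_intros)
      have "AE x in lebesgue_on \<Omega>. g x = f_lim x"
        using g by (simp add: continuous_representative_def)
      with F_eq show "AE x in lebesgue_on \<Omega>. \<bar>g x - F x\<bar> \<le> 0"
        by eventually_elim simp
    qed
    then show ?thesis by simp
  qed
  show ?thesis
  proof (intro conjI exI allI impI)
    show "continuous_representative \<Omega> f_lim F"
      using F_cont F_eq by (simp add: continuous_representative_def)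
    fix g assume g: "continuous_representative \<Omega> f_lim g"
    \<comment> \<open>Outside \<Omega> the functions \<open>g\<close> and \<open>F\<close> may
      differ; openness of \<Omega> makes this invisible to derivatives at its points.\<close>
    have g_der: "GDERIV g x :> G x" if "x \<in> \<Omega>" for x
      using F_der[OF that] unique[OF g] unfolding gderiv_def
      by (auto intro: has_derivative_transform_within_open[OF _ \<Omega> that])
    then show "\<forall>x\<in>\<Omega>. g differentiable (at x)"
      by (auto simp: gderiv_def differentiable_def)
    show "uniform_limit \<Omega> f g sequentially"
      using F by (rule uniform_limit_cong'[THEN iffD1, rotated -1]) (simp_all add: unique[OF g])
    show "uniform_limit \<Omega> (\<lambda>k. grad (f k)) (grad g) sequentially"
      using G by (rule uniform_limit_cong'[THEN iffD1, rotated -1]) (simp_all add: grad_eqI[OF g_der])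
  qed
qed

end
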